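(* Let $P$ be a partially ordered set, equipped with the topology whose subbase consists of the sets $U_a=\{b\in P:a\leq b\}$ and $V_a=P\setminus U_a$, $a\in P$. Then $P$ is Hausdorff and Tychonoff.
   Context: Tychonoff here means: for any closed $F\subset P$ and $a\notin F$ there is a continuous function $f:P\to[0,1]$ with $f(a)=1$ and $f|_F=0$ (together with the Hausdorff property). *)

theory Defs
  imports "HOL-Analysis.Analysis"
begin

definition up_cone :: "'a set \<Rightarrow> 'a rel \<Rightarrow> 'a \<Rightarrow> 'a set"
  where "up_cone P r a = {b \<in> P. (a, b) \<in> r}"

definition cone_topology :: "'a set \<Rightarrow> 'a rel \<Rightarrow> 'a topology"
  where "cone_topology P r =
    topology_generated_by (up_cone P r ` P \<union> (\<lambda>a. P - up_cone P r a) ` P)"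

(* topology_generated_by S is a topology on the union of S, so one has to know
   that the subbase covers P. *)
lemma topspace_cone_topology [simp]: "topspace (cone_topology P r) = P"
  by (auto simp: cone_topology_def up_cone_def)

(* Hausdorff and completely regular. The separating function is normalised to be
   1 at the point and 0 on the closed set, whereas the library constant
   completely_regular_space uses the opposite values; see the lemma below. *)
definition tychonoff_space :: "'a topology \<Rightarrow> bool"
  where "tychonoff_space X \<longleftrightarrow> Hausdorff_space X \<and>
    (\<forall>F a. closedin X F \<and> a \<in> topspace X - F \<longrightarrow>
      (\<exists>f::'a \<Rightarrow> real. continuous_map X (top_of_set {0..1}) f \<and> f a = 1 \<and> (\<forall>x\<in>F. f x = 0)))"

lemma tychonoff_space_iff_completely_regular:
  "tychonoff_space X \<longleftrightarrow> Hausdorff_space X \<and> completely_regular_space X"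
proof -
  have flip: "continuous_map X (top_of_set {0..1}) (\<lambda>x. 1 - f x)"
    if "continuous_map X (top_of_set {0..1}) f" for f :: "'a \<Rightarrow> real"
    using that by (auto simp: continuous_map_in_subtopology intro!: continuous_intros)
  have "(\<exists>f::'a \<Rightarrow> real. continuous_map X (top_of_set {0..1}) f \<and> f a = 1 \<and> (\<forall>x\<in>F. f x = 0))
    \<longleftrightarrow> (\<exists>f::'a \<Rightarrow> real. continuous_map X (top_of_set {0..1}) f \<and> f a = 0 \<and> f ` F \<subseteq> {1})"
    (is "?L \<longleftrightarrow> ?R") for a F
  proof
    assume ?L
    then obtain f :: "'a \<Rightarrow> real" where "continuous_map X (top_of_set {0..1}) f"
      "f a = 1" "\<forall>x\<in>F. f x = 0" by blast
    then show ?R using flip[of f] by (intro exI[of _ "\<lambda>x. 1 - f x"]) auto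
  next
    assume ?R
    then obtain f :: "'a \<Rightarrow> real" where "continuous_map X (top_of_set {0..1}) f"
      "f a = 0" "f ` F \<subseteq> {1}" by blast
    then show ?L using flip[of f] by (intro exI[of _ "\<lambda>x. 1 - f x"]) auto
  qed
  then show ?thesis
    unfolding tychonoff_space_def completely_regular_space_def by simp
qed

end

theory Submission
  imports Defs
begin

text \<open>Every subbasic set and its complement are open, so the space is zero-dimensional, and the
  indicator functions of clopen sets separate points from closed sets. Antisymmetry makes the
  cones separate points.\<close>

text \<open>Induction on the generation of \<open>U\<close>. A subbasic set is itself clopen; for a
  binary intersection the two clopen neighbourhoods are intersected; for a union, the neighbourhood
  found inside a member containing \<open>a\<close> already works.\<close>

lemma clopen_neighbourhood_of_clopen_subbase:
  assumes clopen: "\<And>s. s \<in> S \<Longrightarrow> closedin (topology_generated_by S) s"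
    and "openin (topology_generated_by S) U" and "a \<in> U"
  shows "\<exists>C. openin (topology_generated_by S) C \<and> closedin (topology_generated_by S) C
    \<and> a \<in> C \<and> C \<subseteq> U"
proof -
  have "generate_topology_on S U"
    using assms(2) by (simp add: openin_topology_generated_by)
  then show ?thesis
    using \<open>a \<in> U\<close>
  proof (induction U)
    case Empty
    then show ?case by simp
  next
    case (Int U V)
    then obtain C D where "openin (topology_generated_by S) C" "closedin (topology_generated_by S) C"
      "a \<in> C" "C \<subseteq> U" "openin (topology_generated_by S) D" "closedin (topology_generated_by S) D"
      "a \<in> D" "D \<subseteq> V"
      by blast
    then show ?case
      by (intro exI[of _ "C \<inter> D"]) auto
  next
    case (UN K)
    then show ?case by (meson UnionE Union_upper subset_trans)
  next
    case (Basis s)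
    then show ?case
      using clopen topology_generated_by_Basis by blast
  qed
qed

text \<open>The indicator takes only the values 0 and 1, so the preimage of any set of reals, open
  or not, is a union of some of the two open sets \<open>C\<close> and
  \<open>topspace X - C\<close>.\<close>

lemma continuous_map_indicator_clopen:
  assumes "openin X C" and "closedin X C"
  shows "continuous_map X (top_of_set {0..1}) (indicator C :: 'a \<Rightarrow> real)"
proof -
  have "openin X {x \<in> topspace X. (indicator C x :: real) \<in> U}" for U
  proof -
    have "{x \<in> topspace X. (indicator C x :: real) \<in> U} =
        (if 1 \<in> U then C else {}) \<union> (if 0 \<in> U then topspace X - C else {})"
      using openin_subset[OF assms(1)] by (auto simp: indicator_def split: if_splits)
    then show ?thesis
      using assms by (auto intro!: openin_Un)
  qed
  then show ?thesis
    by (auto simp: continuous_map_in_subtopology continuous_map_def indicator_def)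
qed

lemma openin_up_cone: "a \<in> P \<Longrightarrow> openin (cone_topology P r) (up_cone P r a)"
  unfolding cone_topology_def by (intro topology_generated_by_Basis) blast

lemma openin_Diff_up_cone: "a \<in> P \<Longrightarrow> openin (cone_topology P r) (P - up_cone P r a)"
  unfolding cone_topology_def by (intro topology_generated_by_Basis) blast

text \<open>Complementation in \<open>P\<close> exchanges the two families of subbasic sets, so the
  complement of each is again subbasic and hence open.\<close>

lemma closedin_cone_subbase:
  assumes "s \<in> up_cone P r ` P \<union> (\<lambda>a. P - up_cone P r a) ` P"
  shows "closedin (cone_topology P r) s"
proof -
  have "P - (P - up_cone P r a) = up_cone P r a" for a
    by (auto simp: up_cone_def)
  moreover have "s \<subseteq> P"
    using assms by (auto simp: up_cone_def)
  ultimately show ?thesis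
    using assms by (auto simp: closedin_def openin_up_cone openin_Diff_up_cone)
qed

lemma Hausdorff_space_cone_topology:
  assumes "partial_order_on P r"
  shows "Hausdorff_space (cone_topology P r)"
  unfolding Hausdorff_space_def
proof (intro allI impI)
  fix x y
  assume "x \<in> topspace (cone_topology P r) \<and> y \<in> topspace (cone_topology P r) \<and> x \<noteq> y"
  then have "x \<in> P" "y \<in> P" "x \<noteq> y" by auto
  \<comment> \<open>Reflexivity puts \<open>u\<close> into its own cone. The cone at
    \<open>u\<close> and its complement are then disjoint open sets separating \<open>u\<close> from
    \<open>v\<close>.\<close>
  have separate: "u \<in> up_cone P r u \<and> v \<in> P - up_cone P r u"
    if "u \<in> P" "v \<in> P" "(u, v) \<notin> r" for u v
    using that assms by (auto simp: up_cone_def partial_order_on_def preorder_on_def refl_on_def)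
  \<comment> \<open>By antisymmetry, distinct points cannot be related in both directions. The
    direction that fails decides whether the cone at \<open>x\<close> or the one at \<open>y\<close>
    is used.\<close>
  have "(x, y) \<notin> r \<or> (y, x) \<notin> r"
    using \<open>x \<noteq> y\<close> assms by (auto simp: partial_order_on_def dest: antisymD)
  then show "\<exists>U V. openin (cone_topology P r) U \<and> openin (cone_topology P r) V
      \<and> x \<in> U \<and> y \<in> V \<and> disjnt U V"
  proof
    assume "(x, y) \<notin> r"
    with separate \<open>x \<in> P\<close> \<open>y \<in> P\<close> show ?thesis
      by (intro exI[of _ "up_cone P r x"] exI[of _ "P - up_cone P r x"])
        (auto simp: openin_up_cone openin_Diff_up_cone disjnt_def)
  next
    assume "(y, x) \<notin> r"
    with separate \<open>x \<in> P\<close> \<open>y \<in> P\<close> show ?thesis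
      by (intro exI[of _ "P - up_cone P r y"] exI[of _ "up_cone P r y"])
        (auto simp: openin_up_cone openin_Diff_up_cone disjnt_def)
  qed
qed

theorem lemma3p1:
  fixes P :: "'a set" and r :: "'a rel"
  assumes "partial_order_on P r"
  shows "Hausdorff_space (cone_topology P r) \<and> tychonoff_space (cone_topology P r)"
proof -
  let ?X = "cone_topology P r"
  have "\<exists>f::'a \<Rightarrow> real. continuous_map ?X (top_of_set {0..1}) f \<and> f a = 1 \<and> (\<forall>x\<in>F. f x = 0)"
    if F: "closedin ?X F" and a: "a \<in> topspace ?X - F" for F a
  proof -
    have "openin ?X (topspace ?X - F)"
      using F by blast
    then obtain C where "openin ?X C" "closedin ?X C" "a \<in> C" "C \<subseteq> topspace ?X - F"
      using clopen_neighbourhood_of_clopen_subbase[OF closedin_cone_subbase[unfolded cone_topology_def]]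
        a
      unfolding cone_topology_def by metis
    then show ?thesis
      \<comment> \<open>The indicator is 1 at \<open>a\<close> because \<open>a\<close> lies in
        \<open>C\<close>, and 0 on \<open>F\<close> because \<open>C\<close> avoids
        \<open>F\<close>.\<close>
      by (intro exI[of _ "indicator C"]) (auto simp: continuous_map_indicator_clopen indicator_def)
  qed
  then show ?thesis
    using Hausdorff_space_cone_topology[OF assms] by (simp add: tychonoff_space_def)
qed

end
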